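(* Let $X$ be a finite directed graph and let $u=\sum_{i\in I}d_i f_{n_i}$ be a positive $1$-chain of $X$ ($I$ finite). Then $d_1^X(u)=0$ if and only if there exists a finite family of cycles $g_j:c_{n_j}\to X$ such that the $1$-chains $\sum_{i} d_if_{n_i}$ and $\sum_j g_j\circ p_{n_j}$ have the same image in $Z(X(1))$.
   Context: A directed graph $X$ consists of a set $X(0)$ of nodes, a set $X(1)$ of arcs, and two maps $s,t:X(1)\to X(0)$ (source and target). Morphisms are pairs of maps on nodes and arcs commuting with $s$ and $t$. For $n\ge1$, the path $P_n$ is the graph with nodes $x_0,\dots,x_{n-1}$ and arcs $a_i$ from $x_i$ to $x_{i+1}$ for $0\le i<n-1$; its source is $s(P_n)=x_0$ and its end is $t(P_n)=x_{n-1}$. For $n\ge1$, $c_n$ is the directed cycle with nodes $x_0,\dots,x_{n-1}$ and arcs $a_i$ from $x_i$ to $x_{i+1}$ (indices mod $n$); $c_0=P_1$ is the graph with one node and no arc. A cycle of $X$ is a morphism $c_n\to X$. The canonical morphism $p_n:P_{n+1}\to c_n$ sends $x_i$ to $x_{i \bmod n}$ and $a_i$ to $a_i$ (for $n=0$ it is the identity). $Z(X(0))$ and $Z(X(1))$ are the free abelian groups on the nodes and on the arcs of $X$. A $1$-chain of $X$ is a finite formal sum $u=\sum_{i}d_if_{n_i}$ with $d_i\in\mathbb Z$ and $f_{n_i}:P_{n_i}\to X$ morphisms; $Z(ch(X))$ is the group of $1$-chains. The chain $u$ is positive if all $d_i\ge 0$. The image of $u$ is the element $u'=\sum_i d_i\sum_{a}f_{n_i}(1)(a)$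 of $Z(X(1))$, the inner sum running over all arcs $a$ of $P_{n_i}$. The linear map $d_1^X:Z(ch(X))\to Z(X(0))$ is determined by $d_1^X(f)=f(0)(t(P_n))-f(0)(s(P_n))$ for $f:P_n\to X$. *)

theory Defs
  imports
    "Graph_Theory.Digraph"
    "HOL-Algebra.Free_Abelian_Groups"
    "HOL-Library.FuncSet"
begin

text \<open>
  Directed graphs are the \<^const>\<open>wf_digraph\<close>s of the AFP entry Graph Theory: loops and parallel
  arcs are allowed, \<^const>\<open>tail\<close> is the source map and \<^const>\<open>head\<close> the target map.

  A morphism is a pair (map on nodes, map on arcs). Both maps are extensional, so that two morphisms
  are equal as soon as they agree on the nodes and arcs of the domain; this is needed because
  morphisms serve as a basis of a free abelian group below.
\<close>

definition digraph_hom ::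
  "('a,'b) pre_digraph \<Rightarrow> ('c,'d) pre_digraph \<Rightarrow> (('a \<Rightarrow> 'c) \<times> ('b \<Rightarrow> 'd)) set" where
  "digraph_hom G H =
     {f. fst f \<in> verts G \<rightarrow>\<^sub>E verts H \<and> snd f \<in> arcs G \<rightarrow>\<^sub>E arcs H \<and>
         (\<forall>a\<in>arcs G. tail H (snd f a) = fst f (tail G a) \<and> head H (snd f a) = fst f (head G a))}"

definition hom_compose ::
  "('a,'b) pre_digraph \<Rightarrow> ('c \<Rightarrow> 'e) \<times> ('d \<Rightarrow> 'f) \<Rightarrow> ('a \<Rightarrow> 'c) \<times> ('b \<Rightarrow> 'd) \<Rightarrow> ('a \<Rightarrow> 'e) \<times> ('b \<Rightarrow> 'f)"
  where "hom_compose G g f = (compose (verts G) (fst g) (fst f), compose (arcs G) (snd g) (snd f))"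

text \<open>
  The node \<open>x\<^sub>i\<close> and the arc \<open>a\<^sub>i\<close> of a path or cycle are both represented by the number \<open>i\<close>.
  Only \<open>n \<ge> 1\<close> is meaningful for \<open>path_graph n\<close>.
\<close>

definition path_graph :: "nat \<Rightarrow> (nat, nat) pre_digraph" where
  "path_graph n = \<lparr>verts = {..<n}, arcs = {..<n - 1}, tail = (\<lambda>i. i), head = Suc\<rparr>"

definition path_source :: "nat \<Rightarrow> nat" where
  "path_source n = 0"

definition path_end :: "nat \<Rightarrow> nat" where
  "path_end n = n - 1"

definition cycle_graph :: "nat \<Rightarrow> (nat, nat) pre_digraph" where
  "cycle_graph n =
     (if n = 0 then path_graph 1
      else \<lparr>verts = {..<n}, arcs = {..<n}, tail = (\<lambda>i. i), head = (\<lambda>i. Suc i mod n)\<rparr>)"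

text \<open>For \<open>n = 0\<close> this is the identity of the one-node graph, as \<open>i mod 0 = i\<close>.\<close>

definition cycle_proj :: "nat \<Rightarrow> (nat \<Rightarrow> nat) \<times> (nat \<Rightarrow> nat)" where
  "cycle_proj n = (restrict (\<lambda>i. i mod n) (verts (path_graph (n + 1))),
                   restrict (\<lambda>i. i) (arcs (path_graph (n + 1))))"

text \<open>A path \<open>f : P\<^sub>n \<rightarrow> X\<close> is the pair \<open>(n, f)\<close>, with \<open>f\<close> a morphism.\<close>

type_synonym ('a, 'b) gpath = "nat \<times> (nat \<Rightarrow> 'a) \<times> (nat \<Rightarrow> 'b)"

definition graph_paths :: "('a,'b) pre_digraph \<Rightarrow> ('a,'b) gpath set" where
  "graph_paths X = (SIGMA n:{1..}. digraph_hom (path_graph n) X)"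

definition chain_group :: "('a,'b) pre_digraph \<Rightarrow> (('a,'b) gpath \<Rightarrow>\<^sub>0 int) monoid" where
  "chain_group X = free_Abelian_group (graph_paths X)"

definition positive_chain :: "(('a,'b) gpath \<Rightarrow>\<^sub>0 int) \<Rightarrow> bool" where
  "positive_chain u \<longleftrightarrow> (\<forall>p. Poly_Mapping.lookup u p \<ge> 0)"

definition chain_image :: "(('a,'b) gpath \<Rightarrow>\<^sub>0 int) \<Rightarrow> ('b \<Rightarrow>\<^sub>0 int)" where
  "chain_image = frag_extend (\<lambda>(n, f). \<Sum>a\<in>arcs (path_graph n). frag_of (snd f a))"

definition chain_boundary :: "(('a,'b) gpath \<Rightarrow>\<^sub>0 int) \<Rightarrow> ('a \<Rightarrow>\<^sub>0 int)" where
  "chain_boundary =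
     frag_extend (\<lambda>(n, f). frag_of (fst f (path_end n)) - frag_of (fst f (path_source n)))"

text \<open>The path \<open>g \<circ> p\<^sub>n : P\<^bsub>n+1\<^esub> \<rightarrow> X\<close> obtained from a cycle \<open>g : c\<^sub>n \<rightarrow> X\<close>.\<close>

definition cycle_path :: "nat \<Rightarrow> (nat \<Rightarrow> 'a) \<times> (nat \<Rightarrow> 'b) \<Rightarrow> ('a,'b) gpath" where
  "cycle_path n g = (n + 1, hom_compose (path_graph (n + 1)) g (cycle_proj n))"


lemma wf_path_graph: "n \<ge> 1 \<Longrightarrow> wf_digraph (path_graph n)"
  by (unfold_locales) (auto simp: path_graph_def)

lemma wf_cycle_graph: "wf_digraph (cycle_graph n)"
  by (unfold_locales) (auto simp: cycle_graph_def path_graph_def split: if_splits)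

lemma cycle_proj_hom: "cycle_proj n \<in> digraph_hom (path_graph (n + 1)) (cycle_graph n)"
  by (auto simp: cycle_proj_def digraph_hom_def path_graph_def cycle_graph_def)

lemma hom_compose_hom:
  assumes "wf_digraph G" "f \<in> digraph_hom G H" "g \<in> digraph_hom H K"
  shows "hom_compose G g f \<in> digraph_hom G K"
proof -
  interpret wf_digraph G by fact
  have f: "snd f a \<in> arcs H \<and> tail H (snd f a) = fst f (tail G a) \<and> head H (snd f a) = fst f (head G a)"
    if "a \<in> arcs G" for a
    using assms(2) that by (auto simp: digraph_hom_def)
  have g: "tail K (snd g a) = fst g (tail H a) \<and> head K (snd g a) = fst g (head H a)"
    if "a \<in> arcs H" for a
    using assms(3) that by (auto simp: digraph_hom_def)
  have "compose (verts G) (fst g) (fst f) \<in> verts G \<rightarrow>\<^sub>E verts K"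
    "compose (arcs G) (snd g) (snd f) \<in> arcs G \<rightarrow>\<^sub>E arcs K"
    using assms(2,3) by (auto simp: digraph_hom_def compose_def)
  then show ?thesis
    by (simp add: digraph_hom_def hom_compose_def compose_eq f g)
qed

lemma cycle_path_in_graph_paths:
  assumes "g \<in> digraph_hom (cycle_graph n) X"
  shows "cycle_path n g \<in> graph_paths X"
  using hom_compose_hom[OF wf_path_graph cycle_proj_hom assms]
  by (simp add: cycle_path_def graph_paths_def)

lemma chain_image_hom:
  "chain_image \<in> hom (chain_group X) (free_Abelian_group (arcs X))"
proof -
  have "Poly_Mapping.keys (chain_image u) \<subseteq> arcs X" if "Poly_Mapping.keys u \<subseteq> graph_paths X" for u
  proof -
    have "Poly_Mapping.keys (\<Sum>a\<in>arcs (path_graph n). frag_of (snd f a)) \<subseteq> arcs X"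
      if "(n, f) \<in> graph_paths X" for n f
    proof (intro order_trans[OF keys_sum] UN_least)
      fix a assume "a \<in> arcs (path_graph n)"
      then have "snd f a \<in> arcs X"
        using that by (auto simp: graph_paths_def digraph_hom_def PiE_mem)
      then show "Poly_Mapping.keys (frag_of (snd f a)) \<subseteq> arcs X"
        by simp
    qed
    then show ?thesis
      using that unfolding chain_image_def
      by (intro order_trans[OF keys_frag_extend] UN_least) auto
  qed
  then show ?thesis
    by (auto simp: hom_def chain_group_def chain_image_def frag_extend_add)
qed

lemma chain_boundary_hom:
  "chain_boundary \<in> hom (chain_group X) (free_Abelian_group (verts X))"
proof -
  have "Poly_Mapping.keys (chain_boundary u) \<subseteq> verts X" if "Poly_Mapping.keys u \<subseteq> graph_paths X" for u
  proof -
    have "Poly_Mapping.keys (frag_of (fst f (path_end n)) - frag_of (fst f (path_source n))) \<subseteq> verts X"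
      if "(n, f) \<in> graph_paths X" for n f
    proof -
      have "fst f (path_end n) \<in> verts X" "fst f (path_source n) \<in> verts X"
        using that
        by (auto simp: graph_paths_def digraph_hom_def path_graph_def path_end_def
            path_source_def PiE_mem)
      then show ?thesis
        using keys_diff[of "frag_of (fst f (path_end n))" "frag_of (fst f (path_source n))"]
        by auto
    qed
    then show ?thesis
      using that unfolding chain_boundary_def
      by (intro order_trans[OF keys_frag_extend] UN_least) auto
  qed
  then show ?thesis
    by (auto simp: hom_def chain_group_def chain_boundary_def frag_extend_add)
qed

text \<open>
  \<^const>\<open>positive_chain\<close> looks at the reduced coefficients. The next lemma shows that this amounts to
  being some finite formal sum \<open>\<Sum>\<^sub>i d\<^sub>i f\<^sub>i\<close> (repetitions allowed) with all \<open>d\<^sub>i \<ge> 0\<close>.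
\<close>

lemma positive_chain_formal_sum:
  fixes u :: "('a,'b) gpath \<Rightarrow>\<^sub>0 int"
  shows "u \<in> carrier (chain_group X) \<and> positive_chain u \<longleftrightarrow>
    (\<exists>(I :: ('a,'b) gpath set) d f. finite I \<and> (\<forall>i\<in>I. d i \<ge> 0 \<and> f i \<in> graph_paths X) \<and>
       u = (\<Sum>i\<in>I. frag_cmul (d i) (frag_of (f i))))"
  (is "?L \<longleftrightarrow> ?R")
proof
  assume ?L
  then show ?R
    using frag_expansion[of u]
    by (intro exI[of _ "Poly_Mapping.keys u"] exI[of _ "Poly_Mapping.lookup u"] exI[of _ "\<lambda>i. i"])
       (auto simp: chain_group_def positive_chain_def frag_extend_def)
next
  assume ?R
  then obtain I :: "('a,'b) gpath set" and d f
    where I: "finite I" "\<And>i. i \<in> I \<Longrightarrow> d i \<ge> 0" "\<And>i. i \<in> I \<Longrightarrow> f i \<in> graph_paths X"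
      and u: "u = (\<Sum>i\<in>I. frag_cmul (d i) (frag_of (f i)))" by blast
  have "Poly_Mapping.keys u \<subseteq> graph_paths X"
    unfolding u
  proof (intro order_trans[OF keys_sum] UN_least)
    fix i assume "i \<in> I"
    then show "Poly_Mapping.keys (frag_cmul (d i) (frag_of (f i))) \<subseteq> graph_paths X"
      using I(3) by (intro order_trans[OF keys_cmul]) simp
  qed
  moreover have "Poly_Mapping.lookup u p \<ge> 0" for p
    using I unfolding u by (auto simp: Poly_Mapping.lookup_sum intro!: sum_nonneg)
  ultimately show ?L
    by (simp add: chain_group_def positive_chain_def)
qed

end

theory Submission
  imports Defs
begin

text \<open>
  The boundary of a path telescopes to the sum of \<open>head - tail\<close> over its arcs, so the boundary of a
  chain depends only on its image in \<open>Z(X(1))\<close>, and it vanishes on cycles. Conversely, if a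
  nonnegative combination of arcs has zero boundary, then every arc of its support is followed by
  another arc of the support; as the support is finite, a walk that always follows such successors
  closes up. A shortest closed piece of it is a cycle without repeated arcs, which can be
  subtracted without losing nonnegativity, and the total weight drops.
\<close>

text \<open>The cellular boundary map of \<open>X\<close> seen as a one-dimensional complex;
  \<open>chain_boundary\<close> factors through it by way of \<open>chain_image\<close>.\<close>

definition arc_boundary :: "('a,'b) pre_digraph \<Rightarrow> ('b \<Rightarrow>\<^sub>0 int) \<Rightarrow> ('a \<Rightarrow>\<^sub>0 int)" where
  "arc_boundary X = frag_extend (\<lambda>a. frag_of (head X a) - frag_of (tail X a))"

lemma arc_boundary_chain_image:
  assumes "Poly_Mapping.keys u \<subseteq> graph_paths X"
  shows "arc_boundary X (chain_image u) = chain_boundary u"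
  using assms
proof (induction rule: frag_induction)
  case zero
  then show ?case
    by (simp add: arc_boundary_def chain_image_def chain_boundary_def)
next
  case (one p)
  \<comment> \<open>Paths have at least one node, so the length can be written \<open>Suc n\<close>;
    the arcs are then \<open>{..<n}\<close> and the truncated subtraction disappears.\<close>
  then obtain n f where p: "p = (Suc n, f)" and f: "f \<in> digraph_hom (path_graph (Suc n)) X"
    by (auto simp: graph_paths_def Suc_le_eq gr0_conv_Suc)
  have "arc_boundary X (chain_image (frag_of p)) =
      (\<Sum>i<n. frag_of (head X (snd f i)) - frag_of (tail X (snd f i)))"
    by (simp add: p arc_boundary_def chain_image_def frag_extend_sum path_graph_def comp_def)
  also have "\<dots> = (\<Sum>i<n. frag_of (fst f (Suc i)) - frag_of (fst f i))"
    using f by (intro sum.cong) (auto simp: digraph_hom_def path_graph_def)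
  also have "\<dots> = chain_boundary (frag_of p)"
    using sum_lessThan_telescope[of "\<lambda>i. frag_of (fst f i)" n]
    by (simp add: p chain_boundary_def path_end_def path_source_def)
  finally show ?case .
next
  case (diff a b)
  then show ?case
    by (simp add: arc_boundary_def chain_image_def chain_boundary_def frag_extend_diff)
qed

text \<open>The projection is the identity on arcs, so each arc of the cycle is traversed exactly
  once; for \<open>n = 0\<close> both sides are zero.\<close>

lemma chain_image_cycle_path:
  "chain_image (frag_of (cycle_path n g)) = (\<Sum>i<n. frag_of (snd g i))"
  by (simp add: chain_image_def cycle_path_def hom_compose_def cycle_proj_def path_graph_def
      compose_def)

text \<open>The last node \<open>n\<close> of the path is sent to \<open>n mod n = 0\<close>, the
  image of the first node; this includes \<open>n = 0\<close>.\<close>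

lemma chain_boundary_cycle_path:
  "chain_boundary (frag_of (cycle_path n g)) = 0"
  by (simp add: chain_boundary_def cycle_path_def hom_compose_def cycle_proj_def path_graph_def
      compose_def path_end_def path_source_def)

lemma lookup_chain_image_nonneg:
  assumes "positive_chain u"
  shows "Poly_Mapping.lookup (chain_image u) a \<ge> 0"
  using assms unfolding chain_image_def frag_extend_def positive_chain_def
  by (auto simp: Poly_Mapping.lookup_sum split: prod.split intro!: sum_nonneg mult_nonneg_nonneg)

text \<open>If no arc of the support left \<open>head X a\<close>, the coefficient of the boundary
  at that node would be the total weight of the arcs entering it, which is at least the positive
  weight of \<open>a\<close>.\<close>

lemma arc_boundary_successor:
  assumes "arc_boundary X v = 0"
    and nonneg: "\<And>a. Poly_Mapping.lookup v a \<ge> 0"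
    and a: "a \<in> Poly_Mapping.keys v"
  shows "\<exists>b \<in> Poly_Mapping.keys v. tail X b = head X a"
proof (rule ccontr)
  assume no_succ: "\<not> ?thesis"
  let ?h = "\<lambda>b. if head X b = head X a then Poly_Mapping.lookup v b else 0"
  have "Poly_Mapping.lookup (arc_boundary X v) (head X a) = (\<Sum>b\<in>Poly_Mapping.keys v. ?h b)"
    unfolding arc_boundary_def frag_extend_def Poly_Mapping.lookup_sum
    using no_succ by (intro sum.cong) (auto simp: lookup_minus)
  also have "\<dots> > 0"
    using nonneg a by (intro sum_pos2[of _ a]) (auto simp: in_keys_iff less_le)
  finally show False
    using assms(1) by simp
qed

text \<open>By the pigeonhole principle the orbit of \<open>a\<close> meets some point
  \<open>c\<close> twice; running through the least period of \<open>c\<close> visits no point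
  twice.\<close>

lemma injective_periodic_orbit:
  assumes "finite S" "N \<in> S \<rightarrow> S" "a \<in> S"
  obtains c n where "c \<in> S" "0 < n" "(N ^^ n) c = c" "inj_on (\<lambda>i. (N ^^ i) c) {..<n}"
proof -
  have in_S: "(N ^^ i) a \<in> S" for i
    using assms(2,3) by (induction i) auto
  then have "finite (range (\<lambda>i. (N ^^ i) a))"
    by (intro finite_subset[OF _ assms(1)]) auto
  then have "\<not> inj (\<lambda>i. (N ^^ i) a)"
    using range_inj_infinite by blast
  then obtain i j where "i < j" "(N ^^ i) a = (N ^^ j) a"
    using linorder_injI[of "\<lambda>i. (N ^^ i) a"] by blast
  define c where "c = (N ^^ i) a"
  have "(N ^^ (j - i)) c = (N ^^ (j - i + i)) a"
    by (simp only: c_def funpow_add comp_apply)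
  then have period: "0 < j - i \<and> (N ^^ (j - i)) c = c"
    using \<open>i < j\<close> \<open>(N ^^ i) a = (N ^^ j) a\<close> by (simp add: c_def)
  define n where "n = (LEAST p. 0 < p \<and> (N ^^ p) c = c)"
  have n: "0 < n" "(N ^^ n) c = c"
    using LeastI[of "\<lambda>p. 0 < p \<and> (N ^^ p) c = c", OF period] by (simp_all add: n_def)
  have least: "n \<le> p" if "0 < p" "(N ^^ p) c = c" for p
    using that unfolding n_def by (intro Least_le) simp
  have "(N ^^ k) c \<noteq> (N ^^ l) c" if "k < l" "l < n" for k l
  proof
    assume eq: "(N ^^ k) c = (N ^^ l) c"
    \<comment> \<open>Applying \<open>N ^^ (n - l)\<close> to the coincidence turns it into a return
      to \<open>c\<close> after \<open>n - l + k\<close> steps, a positive number below the least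
      period.\<close>
    have "(N ^^ (n - l + k)) c = (N ^^ (n - l)) ((N ^^ l) c)"
      by (simp add: funpow_add eq)
    also have "\<dots> = (N ^^ (n - l + l)) c"
      by (simp only: funpow_add comp_apply)
    also have "\<dots> = c"
      using that n by simp
    finally show False
      using least[of "n - l + k"] that by simp
  qed
  then have "inj_on (\<lambda>i. (N ^^ i) c) {..<n}"
    by (intro linorder_inj_onI) auto
  then show thesis
    using that n in_S[of i] by (simp add: c_def)
qed

lemma (in wf_digraph) exists_arc_injective_cycle:
  assumes "finite S" "S \<subseteq> arcs G" "S \<noteq> {}"
    and succ: "\<And>a. a \<in> S \<Longrightarrow> \<exists>b\<in>S. tail G b = head G a"
  obtains n g where "0 < n" "g \<in> digraph_hom (cycle_graph n) G"
    "snd g ` {..<n} \<subseteq> S" "inj_on (snd g) {..<n}"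
proof -
  obtain N where N: "\<And>a. a \<in> S \<Longrightarrow> N a \<in> S \<and> tail G (N a) = head G a"
    using succ by metis
  obtain c n where c: "c \<in> S" "0 < n" "(N ^^ n) c = c" "inj_on (\<lambda>i. (N ^^ i) c) {..<n}"
    using injective_periodic_orbit[of S N] assms(1,3) N by blast
  \<comment> \<open>The arcs of the cycle are the iterates of the successor choice \<open>N\<close>,
    and its nodes are their tails. Only the arcs are made distinct; nodes may repeat.\<close>
  define g where
    "g = (restrict (\<lambda>i. tail G ((N ^^ i) c)) {..<n}, restrict (\<lambda>i. (N ^^ i) c) {..<n})"
  have in_S: "(N ^^ i) c \<in> S" for i
    using c(1) N by (induction i) auto
  have "head G ((N ^^ i) c) = tail G ((N ^^ (Suc i mod n)) c)" if "i < n" for i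
  proof -
    have "head G ((N ^^ i) c) = tail G ((N ^^ Suc i) c)"
      using N[OF in_S] by simp
    \<comment> \<open>The index wraps only at \<open>Suc i = n\<close>, where periodicity returns to
      \<open>c\<close>.\<close>
    also have "(N ^^ Suc i) c = (N ^^ (Suc i mod n)) c"
      using that c(3) by (cases "Suc i = n") auto
    finally show ?thesis .
  qed
  then have "g \<in> digraph_hom (cycle_graph n) G"
    using c(2) in_S subsetD[OF assms(2) in_S]
    by (auto simp: digraph_hom_def cycle_graph_def g_def)
  moreover have "snd g ` {..<n} \<subseteq> S" "inj_on (snd g) {..<n}"
    using in_S c(4) by (auto simp: g_def inj_on_def)
  ultimately show thesis
    using that c(2) by blast
qed

text \<open>Applied to a cycle without repeated arcs, this bounds its coefficients by 1, so that
  subtracting it keeps positive integer weights on its arcs nonnegative.\<close>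

lemma lookup_sum_frag_of_inj:
  assumes "finite I" "inj_on f I"
  shows "Poly_Mapping.lookup (\<Sum>i\<in>I. frag_of (f i)) a = (if a \<in> f ` I then 1 else 0)"
proof -
  have "(\<Sum>i\<in>I. frag_of (f i)) = (\<Sum>b\<in>f ` I. frag_of b)"
    using assms(2) by (simp add: sum.reindex)
  then show ?thesis
    using assms(1) by (simp add: Poly_Mapping.lookup_sum)
qed

lemma (in wf_digraph) cycle_decomposition:
  assumes "Poly_Mapping.keys v \<subseteq> arcs G"
    and "\<And>a. Poly_Mapping.lookup v a \<ge> 0"
    and "arc_boundary G v = 0"
  shows "\<exists>(k::nat) n g. (\<forall>j<k. g j \<in> digraph_hom (cycle_graph (n j)) G) \<and>
    v = chain_image (\<Sum>j<k. frag_of (cycle_path (n j) (g j)))"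
  using assms
proof (induction "nat (\<Sum>a\<in>Poly_Mapping.keys v. Poly_Mapping.lookup v a)" arbitrary: v
    rule: less_induct)
  case less
  note v = less.prems
  let ?S = "Poly_Mapping.keys v"
  show ?case
  proof (cases "v = 0")
    case True
    then show ?thesis
      by (intro exI[of _ 0]) (simp add: chain_image_def)
  next
    case False
    then obtain m h where h: "0 < m" "h \<in> digraph_hom (cycle_graph m) G"
      "snd h ` {..<m} \<subseteq> ?S" "inj_on (snd h) {..<m}"
      using exists_arc_injective_cycle[of ?S] v arc_boundary_successor[OF v(3,2)]
      by (metis finite_keys keys_eq_empty)
    define w where "w = chain_image (frag_of (cycle_path m h))"
    have lookup_w: "Poly_Mapping.lookup w a = (if a \<in> snd h ` {..<m} then 1 else 0)" for a
      unfolding w_def chain_image_cycle_path using h(4) by (intro lookup_sum_frag_of_inj) auto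
    have nonneg: "Poly_Mapping.lookup (v - w) a \<ge> 0" for a
    proof (cases "a \<in> snd h ` {..<m}")
      case True
      \<comment> \<open>A nonzero nonnegative integer is at least 1, which pays for the one
        traversal of \<open>a\<close>.\<close>
      then have "Poly_Mapping.lookup v a \<noteq> 0"
        using h(3) by (auto simp: in_keys_iff)
      with v(2)[of a] True show ?thesis
        by (simp add: lookup_minus lookup_w)
    qed (use v(2) in \<open>simp add: lookup_minus lookup_w\<close>)
    have keys: "Poly_Mapping.keys (v - w) \<subseteq> ?S"
    proof
      fix a
      assume "a \<in> Poly_Mapping.keys (v - w)"
      then show "a \<in> ?S"
        using h(3) by (cases "a \<in> snd h ` {..<m}") (auto simp: in_keys_iff lookup_minus lookup_w)
    qed
    have "arc_boundary G w = 0"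
      using arc_boundary_chain_image[of "frag_of (cycle_path m h)" G]
        cycle_path_in_graph_paths[OF h(2)]
      by (simp add: w_def chain_boundary_cycle_path)
    then have boundary: "arc_boundary G (v - w) = 0"
      using v(3) by (simp add: arc_boundary_def frag_extend_diff)
    \<comment> \<open>Subtraction may shrink the support; padding with zeros lets both weights be
      compared over \<open>?S\<close>.\<close>
    have "(\<Sum>a\<in>Poly_Mapping.keys (v - w). Poly_Mapping.lookup (v - w) a) =
        (\<Sum>a\<in>?S. Poly_Mapping.lookup (v - w) a)"
      using keys by (intro sum.mono_neutral_left) (auto simp: in_keys_iff)
    also have "\<dots> < (\<Sum>a\<in>?S. Poly_Mapping.lookup v a)"
    proof (rule sum_strict_mono_ex1)
      \<comment> \<open>Since \<open>0 < m\<close>, the cycle has an arc \<open>snd h 0\<close>,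
        where the weight drops strictly.\<close>
      show "\<exists>a\<in>?S. Poly_Mapping.lookup (v - w) a < Poly_Mapping.lookup v a"
        using h(1,3) by (intro bexI[of _ "snd h 0"]) (auto simp: lookup_minus lookup_w)
    qed (auto simp: lookup_minus lookup_w)
    finally have "nat (\<Sum>a\<in>Poly_Mapping.keys (v - w). Poly_Mapping.lookup (v - w) a) <
        nat (\<Sum>a\<in>?S. Poly_Mapping.lookup v a)"
      using nonneg by (subst nat_less_eq_zless) (auto intro: sum_nonneg)
    from less.hyps[OF this order_trans[OF keys v(1)] nonneg boundary]
    obtain k :: nat and n g where g: "\<forall>j<k. g j \<in> digraph_hom (cycle_graph (n j)) G"
      and vw: "v - w = chain_image (\<Sum>j<k. frag_of (cycle_path (n j) (g j)))"
      by blast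
    \<comment> \<open>The removed cycle is appended at the fresh index \<open>k\<close>, leaving the
      earlier members of the family unchanged.\<close>
    have "(\<Sum>j<Suc k. frag_of (cycle_path ((n(k := m)) j) ((g(k := h)) j))) =
        (\<Sum>j<k. frag_of (cycle_path (n j) (g j))) + frag_of (cycle_path m h)"
      by simp
    then have "v = chain_image (\<Sum>j<Suc k. frag_of (cycle_path ((n(k := m)) j) ((g(k := h)) j)))"
      using vw by (simp only: chain_image_def frag_extend_add w_def) (simp add: algebra_simps)
    moreover have "\<forall>j<Suc k. (g(k := h)) j \<in> digraph_hom (cycle_graph ((n(k := m)) j)) G"
      using g h(2) by (simp add: less_Suc_eq)
    ultimately show ?thesis
      by blast
  qed
qed

theorem proposition5p1:
  fixes X :: "('a, 'b) pre_digraph"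
    and u :: "('a, 'b) gpath \<Rightarrow>\<^sub>0 int"
  assumes "fin_digraph X"
    and "u \<in> carrier (chain_group X)"
    and "positive_chain u"
  shows "chain_boundary u = 0 \<longleftrightarrow>
    (\<exists>(J :: nat set) (n :: nat \<Rightarrow> nat) g.
       finite J \<and>
       (\<forall>j\<in>J. g j \<in> digraph_hom (cycle_graph (n j)) X) \<and>
       chain_image u = chain_image (\<Sum>j\<in>J. frag_of (cycle_path (n j) (g j))))"
proof -
  interpret fin_digraph X by fact
  have u: "Poly_Mapping.keys u \<subseteq> graph_paths X"
    using assms(2) by (simp add: chain_group_def)
  show ?thesis
  proof
    assume "chain_boundary u = 0"
    then have "arc_boundary X (chain_image u) = 0"
      by (simp add: arc_boundary_chain_image[OF u])
    moreover have "Poly_Mapping.keys (chain_image u) \<subseteq> arcs X"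
      using hom_in_carrier[OF chain_image_hom assms(2)] by simp
    ultimately obtain k n g where "\<forall>j<k::nat. g j \<in> digraph_hom (cycle_graph (n j)) X"
      "chain_image u = chain_image (\<Sum>j<k. frag_of (cycle_path (n j) (g j)))"
      using cycle_decomposition[OF _ lookup_chain_image_nonneg[OF assms(3)]] by blast
    then show "\<exists>(J :: nat set) (n :: nat \<Rightarrow> nat) g. finite J \<and>
       (\<forall>j\<in>J. g j \<in> digraph_hom (cycle_graph (n j)) X) \<and>
       chain_image u = chain_image (\<Sum>j\<in>J. frag_of (cycle_path (n j) (g j)))"
      by (intro exI[of _ "{..<k}"] exI[of _ n] exI[of _ g]) simp
  next
    assume "\<exists>(J :: nat set) (n :: nat \<Rightarrow> nat) g. finite J \<and>
       (\<forall>j\<in>J. g j \<in> digraph_hom (cycle_graph (n j)) X) \<and>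
       chain_image u = chain_image (\<Sum>j\<in>J. frag_of (cycle_path (n j) (g j)))"
    then obtain J :: "nat set" and n g where J: "finite J"
      and g: "\<And>j. j \<in> J \<Longrightarrow> g j \<in> digraph_hom (cycle_graph (n j)) X"
      and eq: "chain_image u = chain_image (\<Sum>j\<in>J. frag_of (cycle_path (n j) (g j)))"
      by blast
    \<comment> \<open>Both chains are supported on genuine paths of \<open>X\<close>, so their equal
      images force equal boundaries, and each closed path contributes zero.\<close>
    have "Poly_Mapping.keys (\<Sum>j\<in>J. frag_of (cycle_path (n j) (g j))) \<subseteq> graph_paths X"
      using cycle_path_in_graph_paths[OF g] by (intro order_trans[OF keys_sum] UN_least) simp
    from arc_boundary_chain_image[OF this] arc_boundary_chain_image[OF u]
    have "chain_boundary u = chain_boundary (\<Sum>j\<in>J. frag_of (cycle_path (n j) (g j)))"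
      unfolding eq by simp
    also have "\<dots> = (\<Sum>j\<in>J. chain_boundary (frag_of (cycle_path (n j) (g j))))"
      unfolding chain_boundary_def by (simp only: frag_extend_sum[OF J] comp_def)
    also have "\<dots> = 0"
      by (simp add: chain_boundary_cycle_path)
    finally show "chain_boundary u = 0" .
  qed
qed

end
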